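(* Let $0<r_\alpha\le r_\beta$ and $0<\theta_\alpha<\theta_\beta<2\pi$, and let $(x,y)\ne(0,0)$ be reachable, i.e. there exist $r\in[r_\alpha,r_\beta]$, $\theta_c\in[\theta_\alpha,\theta_\beta]$ and $d>0$ with $H_{r,\theta_c}(d)=(x,y)$. Let $d_{\max}(x,y)$ be the supremum of all such $d$. Then: (i) if $x^2+y^2>2r_\beta y$ and $\Theta(x,y,r_\beta)\le\theta_\beta$, then $d_{\max}(x,y)=L(x,y,\Theta(x,y,r_\beta),r_\beta)$; (ii) if $\big(x^2+y^2>2r_\beta y\land\theta_\beta<\Theta(x,y,r_\beta)\big)\lor\big(r_\alpha\le r_m\le r_\beta\land\theta_\beta<\theta_m\big)$, then $d_{\max}(x,y)=L(x,y,\theta_\beta,R(x,y,\theta_\beta))$; (iii) if $r_\alpha\le r_m\le r_\beta$ and $\theta_m\le\theta_\beta$, then $d_{\max}(x,y)=L(x,y,\theta_m,r_m)$.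
   Context: Left turn-to-bearing path from the origin with initial heading $+x$, radius $r>0$, bearing offset $0<\theta_c<2\pi$: $H_{r,\theta_c}(d)=(r\sin(d/r),\ r(1-\cos(d/r)))$ for $0\le d\le r\theta_c$ and $H_{r,\theta_c}(d)=((d-r\theta_c)\cos\theta_c+r\sin\theta_c,\ (d-r\theta_c)\sin\theta_c+r(1-\cos\theta_c))$ for $d>r\theta_c$. $\theta_m=2\,\mathrm{atan2}(y,x)$ with $\mathrm{atan2}\in(-\pi,\pi]$ the polar angle; $r_m=(x^2+y^2)/(2y)$, defined for $y\ne0$ (conditions involving $r_m$ are understood to require $y\ne0$). $R(x,y,\theta)=\dfrac{x\sin\theta-y\cos\theta}{1-\cos\theta}$. $L(x,y,\theta,r)=r\theta+\|(x,y)-r(\sin\theta,1-\cos\theta)\|$. $\Theta(x,y,r)=2\,\mathrm{atan}\!\Big(\dfrac{x-\sqrt{x^2-(2r-y)y}}{2r-y}\Big)+P(x,y,r)$ if $2r-y\ne0$; $2\,\mathrm{atan}(y/(2x))$ if $2r=y$, $x>0$; $\pi\,\mathrm{sign}(r)$ if $2r=y$, $x\le0$; $\mathrm{atan}\in(-\pi/2,\pi/2)$. $P(x,y,r)=0$ if $\big(0<r\land((0<x\land0<y)\lor(x\le0\land 2r<y))\big)\lor\big(r<0\land((x<0\land y<0)\lor y<2r)\big)$; $P=2\pi$ if $0<r\land((0\le x\land y<0)\lor(x<0\land y<2r))$; $P=-2\pi$ if $r<0\land((0\le x\land 0<y)\lor(x<0\land 2r<y))$. *)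

theory Defs
  imports "HOL-Analysis.Analysis"
begin

definition turn_path :: "real \<Rightarrow> real \<Rightarrow> real \<Rightarrow> real \<times> real" where
  "turn_path r \<theta>c d =
     (if d \<le> r * \<theta>c
      then (r * sin (d / r), r * (1 - cos (d / r)))
      else ((d - r * \<theta>c) * cos \<theta>c + r * sin \<theta>c,
            (d - r * \<theta>c) * sin \<theta>c + r * (1 - cos \<theta>c)))"

definition path_lengths ::
  "real \<Rightarrow> real \<Rightarrow> real \<Rightarrow> real \<Rightarrow> real \<Rightarrow> real \<Rightarrow> real set" where
  "path_lengths r\<alpha> r\<beta> \<theta>\<alpha> \<theta>\<beta> x y =
     {d. d > 0 \<and> (\<exists>r\<in>{r\<alpha>..r\<beta>}. \<exists>\<theta>c\<in>{\<theta>\<alpha>..\<theta>\<beta>}. turn_path r \<theta>c d = (x, y))}"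

definition reachable ::
  "real \<Rightarrow> real \<Rightarrow> real \<Rightarrow> real \<Rightarrow> real \<Rightarrow> real \<Rightarrow> bool" where
  "reachable r\<alpha> r\<beta> \<theta>\<alpha> \<theta>\<beta> x y \<longleftrightarrow>
     (\<exists>r\<in>{r\<alpha>..r\<beta>}. \<exists>\<theta>c\<in>{\<theta>\<alpha>..\<theta>\<beta>}. \<exists>d>0. turn_path r \<theta>c d = (x, y))"

definition d_max ::
  "real \<Rightarrow> real \<Rightarrow> real \<Rightarrow> real \<Rightarrow> real \<Rightarrow> real \<Rightarrow> real" where
  "d_max r\<alpha> r\<beta> \<theta>\<alpha> \<theta>\<beta> x y = Sup (path_lengths r\<alpha> r\<beta> \<theta>\<alpha> \<theta>\<beta> x y)"

text \<open>For a reachable point the supremum in \<^const>\<open>d_max\<close> is over a nonempty set that is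
  bounded above, so the real-valued \<^const>\<open>Sup\<close> is the genuine least upper bound.\<close>

lemma path_lengths_nonempty:
  "path_lengths r\<alpha> r\<beta> \<theta>\<alpha> \<theta>\<beta> x y \<noteq> {} \<longleftrightarrow> reachable r\<alpha> r\<beta> \<theta>\<alpha> \<theta>\<beta> x y"
  unfolding path_lengths_def reachable_def by blast

lemma bdd_above_path_lengths:
  assumes "0 < r\<alpha>" "0 < \<theta>\<alpha>"
  shows "bdd_above (path_lengths r\<alpha> r\<beta> \<theta>\<alpha> \<theta>\<beta> x y)"
proof (rule bdd_aboveI)
  fix d assume "d \<in> path_lengths r\<alpha> r\<beta> \<theta>\<alpha> \<theta>\<beta> x y"
  then obtain r t where r: "r\<alpha> \<le> r" "r \<le> r\<beta>" and t: "\<theta>\<alpha> \<le> t" "t \<le> \<theta>\<beta>"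
    and eq: "turn_path r t d = (x, y)"
    by (auto simp: path_lengths_def)
  have rt: "r * t \<le> r\<beta> * \<theta>\<beta>"
    using assms r t by (intro mult_mono) auto
  show "d \<le> r\<beta> * \<theta>\<beta> + (\<bar>x\<bar> + \<bar>y\<bar> + 3 * r\<beta>)"
  proof (cases "d \<le> r * t")
    case True
    then show ?thesis using rt assms r by linarith
  next
    case False
    define e where "e = d - r * t"
    have e: "e > 0" using False by (simp add: e_def)
    have x: "e * cos t = x - r * sin t" and y: "e * sin t = y - r * (1 - cos t)"
      using eq False by (auto simp: turn_path_def e_def)
    have rs: "\<bar>r * sin t\<bar> \<le> r"
      using assms r mult_left_mono[OF abs_sin_le_one[of t], of r] by (simp add: abs_mult)
    have rc: "\<bar>r * (1 - cos t)\<bar> \<le> 2 * r"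
      using assms r mult_left_mono[of "\<bar>1 - cos t\<bar>" 2 r] cos_le_one[of t] cos_ge_minus_one[of t]
      by (simp add: abs_mult)
    have "e = \<bar>e\<bar> * 1" using e by simp
    also have "\<dots> \<le> \<bar>e\<bar> * (\<bar>cos t\<bar> + \<bar>sin t\<bar>)"
    proof (rule mult_left_mono)
      have "(cos t)\<^sup>2 \<le> \<bar>cos t\<bar>" "(sin t)\<^sup>2 \<le> \<bar>sin t\<bar>"
        using mult_left_mono[OF abs_cos_le_one[of t], of "\<bar>cos t\<bar>"]
          mult_left_mono[OF abs_sin_le_one[of t], of "\<bar>sin t\<bar>"]
        by (simp_all add: power2_eq_square abs_mult_self_eq)
      then show "1 \<le> \<bar>cos t\<bar> + \<bar>sin t\<bar>"
        using sin_cos_squared_add[of t] by linarith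
    qed simp
    also have "\<dots> = \<bar>e * cos t\<bar> + \<bar>e * sin t\<bar>"
      by (simp add: abs_mult distrib_left)
    also have "\<dots> \<le> (\<bar>x\<bar> + r) + (\<bar>y\<bar> + 2 * r)"
      unfolding x y using rs rc by linarith
    finally show ?thesis using rt r by (simp add: e_def)
  qed
qed

text \<open>\<^const>\<open>Arg\<close> takes values in \<open>(-pi, pi]\<close>, so \<open>Arg (Complex x y)\<close> is \<open>atan2 (y, x)\<close>.\<close>

definition theta_m :: "real \<Rightarrow> real \<Rightarrow> real" where
  "theta_m x y = 2 * Arg (Complex x y)"

text \<open>Meaningful only for \<open>y \<noteq> 0\<close>.\<close>

definition r_m :: "real \<Rightarrow> real \<Rightarrow> real" where
  "r_m x y = (x\<^sup>2 + y\<^sup>2) / (2 * y)"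

definition R_fun :: "real \<Rightarrow> real \<Rightarrow> real \<Rightarrow> real" where
  "R_fun x y \<theta> = (x * sin \<theta> - y * cos \<theta>) / (1 - cos \<theta>)"

definition L_fun :: "real \<Rightarrow> real \<Rightarrow> real \<Rightarrow> real \<Rightarrow> real" where
  "L_fun x y \<theta> r = r * \<theta> + norm ((x, y) - r *\<^sub>R (sin \<theta>, 1 - cos \<theta>))"

text \<open>The case distinction does not cover all arguments; the remaining ones are left unspecified.
  For \<open>r > 0\<close> the cases are disjoint. For \<open>r < 0\<close> the first and third overlap, and the first
  takes precedence.\<close>

definition P_fun :: "real \<Rightarrow> real \<Rightarrow> real \<Rightarrow> real" where
  "P_fun x y r =
     (if (0 < r \<and> ((0 < x \<and> 0 < y) \<or> (x \<le> 0 \<and> 2 * r < y))) \<or>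
         (r < 0 \<and> ((x < 0 \<and> y < 0) \<or> y < 2 * r)) then 0
      else if 0 < r \<and> ((0 \<le> x \<and> y < 0) \<or> (x < 0 \<and> y < 2 * r)) then 2 * pi
      else if r < 0 \<and> ((0 \<le> x \<and> 0 < y) \<or> (x < 0 \<and> 2 * r < y)) then - 2 * pi
      else undefined)"

definition Theta_fun :: "real \<Rightarrow> real \<Rightarrow> real \<Rightarrow> real" where
  "Theta_fun x y r =
     (if 2 * r - y \<noteq> 0
      then 2 * arctan ((x - sqrt (x\<^sup>2 - (2 * r - y) * y)) / (2 * r - y)) + P_fun x y r
      else if 0 < x then 2 * arctan (y / (2 * x))
      else pi * sgn r)"

end

theory Submission
  imports Defs
begin

text \<open>In terms of \<open>c = cot (\<theta> / 2)\<close>, the path of final bearing \<open>\<theta>\<close> through \<open>(x, y)\<close> has the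
  radius \<open>R = x * c - y * (c\<^sup>2 - 1) / 2\<close> and a final straight segment of signed length \<open>y * c - x\<close>.
  A path is admissible when this length is nonnegative; as it is affine in \<open>c\<close>, the admissible
  bearings form an interval. There both the radius and the total length are nondecreasing in \<open>\<theta>\<close>:
  with \<open>u = \<theta> / 2\<close> the derivative of the total length is
  \<open>(y * c - x) * (u - sin u * cos u) / (sin u)\<^sup>2\<close>. Hence the longest path is the one
  of largest bearing, limited by \<open>\<theta>\<beta>\<close>, by the radius \<open>r\<beta>\<close> (bearing \<open>\<Theta>\<close>), or by the
  straight segment shrinking to a point (bearing \<open>\<theta>\<^sub>m\<close>).\<close>

section \<open>Paths through a point, parametrised by their final bearing\<close>

definition seg :: "real \<Rightarrow> real \<Rightarrow> real \<Rightarrow> real" where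
  "seg x y \<theta> = y * cot (\<theta> / 2) - x"

definition travel :: "real \<Rightarrow> real \<Rightarrow> real \<Rightarrow> real" where
  "travel x y \<theta> = R_fun x y \<theta> * \<theta> + seg x y \<theta>"

lemma sin_cos_half:
  fixes \<theta> :: real
  shows "sin \<theta> = 2 * sin (\<theta> / 2) * cos (\<theta> / 2)" "cos \<theta> = 1 - 2 * (sin (\<theta> / 2))\<^sup>2"
  using sin_double[of "\<theta> / 2"] cos_double_sin[of "\<theta> / 2"] by auto

lemma sin_half_pos:
  fixes \<theta> :: real
  assumes "0 < \<theta>" "\<theta> < 2 * pi"
  shows "0 < sin (\<theta> / 2)"
  using assms by (intro sin_gt_zero) auto

lemma cot_decreasing:
  fixes a b :: real
  assumes "0 < a" "a < b" "b < pi"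
  shows "cot b < cot a"
proof -
  have "0 < sin a" "0 < sin b" "0 < sin (b - a)"
    using assms by (auto intro!: sin_gt_zero)
  moreover have "sin (b - a) = sin b * cos a - cos b * sin a"
    by (simp add: sin_diff)
  ultimately show ?thesis
    by (simp add: cot_def divide_simps mult.commute)
qed

text \<open>The half-angle formulas make the radius a quadratic polynomial in the cotangent, so that
  its differences and its derivative become plain algebra.\<close>

lemma R_fun_cot:
  assumes "0 < \<theta>" "\<theta> < 2 * pi"
  shows "R_fun x y \<theta> = x * cot (\<theta> / 2) - y * ((cot (\<theta> / 2))\<^sup>2 - 1) / 2"
proof -
  define S C where "S = sin (\<theta> / 2)" and "C = cos (\<theta> / 2)"
  have S: "S > 0" using sin_half_pos[OF assms] by (simp add: S_def)
  have C: "C\<^sup>2 = 1 - S\<^sup>2" by (simp add: S_def C_def cos_squared_eq)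
  have "R_fun x y \<theta> = (x * (2 * S * C) - y * (1 - 2 * S\<^sup>2)) / (2 * S\<^sup>2)"
    by (simp add: R_fun_def sin_cos_half[of \<theta>] S_def C_def)
  also have "\<dots> = x * (C / S) - y * ((1 - S\<^sup>2) / S\<^sup>2 - 1) / 2"
    using S by (simp add: field_simps power2_eq_square)
  also have "(1 - S\<^sup>2) / S\<^sup>2 = (C / S)\<^sup>2"
    by (simp add: C power_divide)
  finally show ?thesis by (simp add: cot_def S_def C_def)
qed

text \<open>For fixed \<theta> the end-point equations are linear in \<open>(e, r)\<close> with
  determinant \<open>cos \<theta> - 1\<close>, nonzero on the open interval, so the solution is
  unique. The signs of \<open>e\<close> and \<open>r\<close> are left free.\<close>

lemma end_point_iff:
  assumes "0 < \<theta>" "\<theta> < 2 * pi"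
  shows "x = e * cos \<theta> + r * sin \<theta> \<and> y = e * sin \<theta> + r * (1 - cos \<theta>)
    \<longleftrightarrow> r = R_fun x y \<theta> \<and> e = seg x y \<theta>"
proof -
  define S C where "S = sin (\<theta> / 2)" and "C = cos (\<theta> / 2)"
  have S: "S > 0" using sin_half_pos[OF assms] by (simp add: S_def)
  have C: "S * S + C * C = 1"
    using sin_cos_squared_add[of "\<theta> / 2"] by (simp add: S_def C_def power2_eq_square)
  have sc: "sin \<theta> = 2 * S * C" "cos \<theta> = 1 - 2 * (S * S)"
    using sin_cos_half[of \<theta>] by (auto simp: S_def C_def power2_eq_square)
  have R: "r = R_fun x y \<theta> \<longleftrightarrow> r * (2 * (S * S)) = x * (2 * S * C) - y * (1 - 2 * (S * S))" for r
    using S by (simp add: R_fun_def sc field_simps)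
  have e: "e = seg x y \<theta> \<longleftrightarrow> e * S = y * C - x * S" for e
    using S by (simp add: seg_def cot_def S_def C_def field_simps)
  show ?thesis unfolding R e sc
  proof (intro iffI conjI; elim conjE)
    assume x: "x = e * (1 - 2 * (S * S)) + r * (2 * S * C)"
      and y: "y = e * (2 * S * C) + r * (1 - (1 - 2 * (S * S)))"
    show "r * (2 * (S * S)) = x * (2 * S * C) - y * (1 - 2 * (S * S))"
      unfolding x y using C by algebra
  next
    assume x: "x = e * (1 - 2 * (S * S)) + r * (2 * S * C)"
      and y: "y = e * (2 * S * C) + r * (1 - (1 - 2 * (S * S)))"
    show "e * S = y * C - x * S"
      unfolding x y using C by algebra
  next
    assume r: "r * (2 * (S * S)) = x * (2 * S * C) - y * (1 - 2 * (S * S))"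
      and e: "e * S = y * C - x * S"
    \<comment> \<open>The hypotheses carry powers of \<open>S\<close> on their left sides, so the
      equation is derived multiplied by \<open>S\<close>, which then cancels.\<close>
    have "S * x = S * (e * (1 - 2 * (S * S)) + r * (2 * S * C))"
      using r e C by algebra
    then show "x = e * (1 - 2 * (S * S)) + r * (2 * S * C)" using S by simp
  next
    assume r: "r * (2 * (S * S)) = x * (2 * S * C) - y * (1 - 2 * (S * S))"
      and e: "e * S = y * C - x * S"
    have "S * y = S * (e * (2 * S * C) + r * (1 - (1 - 2 * (S * S))))"
      using r e C by algebra
    then show "y = e * (2 * S * C) + r * (1 - (1 - 2 * (S * S)))" using S by simp
  qed
qed

text \<open>By the end-point equations the vector inside the norm is \<open>seg x y \<theta>\<close>
  times the unit vector of direction \<theta>; nonnegativity removes the absolute value.\<close>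

lemma L_fun_eq_travel:
  assumes "0 < \<theta>" "\<theta> < 2 * pi" "0 \<le> seg x y \<theta>"
  shows "L_fun x y \<theta> (R_fun x y \<theta>) = travel x y \<theta>"
proof -
  define e where "e = seg x y \<theta>"
  have "x - R_fun x y \<theta> * sin \<theta> = e * cos \<theta>"
    "y - R_fun x y \<theta> * (1 - cos \<theta>) = e * sin \<theta>"
    using end_point_iff[OF assms(1,2), of x e "R_fun x y \<theta>" y] by (auto simp: e_def)
  moreover have "(e * cos \<theta>)\<^sup>2 + (e * sin \<theta>)\<^sup>2 = e\<^sup>2"
    by (simp add: power_mult_distrib flip: distrib_left)
  ultimately have "norm ((x, y) - R_fun x y \<theta> *\<^sub>R (sin \<theta>, 1 - cos \<theta>)) = \<bar>e\<bar>"
    by (simp add: norm_Pair)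
  then show ?thesis
    using assms(3) by (simp add: L_fun_def travel_def e_def)
qed

section \<open>Admissible bearings, and monotonicity of radius and length along them\<close>

lemma seg_nonneg_between:
  assumes "0 < a" "a \<le> \<theta>" "\<theta> \<le> b" "b < 2 * pi" "0 \<le> seg x y a" "0 \<le> seg x y b"
  shows "0 \<le> seg x y \<theta>"
proof -
  have c: "cot (b / 2) \<le> cot (\<theta> / 2)" "cot (\<theta> / 2) \<le> cot (a / 2)"
    using cot_decreasing[of "\<theta> / 2" "b / 2"] cot_decreasing[of "a / 2" "\<theta> / 2"] assms
    by (cases "\<theta> = b"; cases "\<theta> = a"; force)+
  show ?thesis
  \<comment> \<open>An affine function of the cotangent is smallest at an end of the interval: at
    \<open>b\<close> if \<open>y\<close> is nonnegative, at \<open>a\<close> otherwise.\<close>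
  proof (cases "0 \<le> y")
    case True
    then show ?thesis using mult_left_mono[OF c(1) True] assms(6) unfolding seg_def by linarith
  next
    case False
    then show ?thesis using mult_left_mono_neg[OF c(2), of y] assms(5) unfolding seg_def by linarith
  qed
qed

text \<open>If \<open>y > 0\<close>, the cotangent is still strictly above its value at
  \<open>b\<close>; otherwise \<open>seg\<close> does not fall below its positive value at
  \<open>a\<close>.\<close>

lemma seg_pos_between:
  assumes "0 < a" "a \<le> \<theta>" "\<theta> < b" "b < 2 * pi" "0 < seg x y a" "0 \<le> seg x y b"
  shows "0 < seg x y \<theta>"
proof -
  have c: "cot (b / 2) < cot (\<theta> / 2)" "cot (\<theta> / 2) \<le> cot (a / 2)"
    using cot_decreasing[of "\<theta> / 2" "b / 2"] cot_decreasing[of "a / 2" "\<theta> / 2"] assms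
    by (cases "\<theta> = a"; force)+
  show ?thesis
  proof (cases "0 < y")
    case True
    then show ?thesis using mult_strict_left_mono[OF c(1) True] assms(6) unfolding seg_def by linarith
  next
    case False
    then show ?thesis using mult_left_mono_neg[OF c(2), of y] assms(5) unfolding seg_def by linarith
  qed
qed

text \<open>As a function of the cotangent the radius has derivative \<open>- seg\<close>. This is
  affine, so the trapezoidal rule integrates it exactly.\<close>

lemma R_fun_diff:
  assumes "0 < a" "a < 2 * pi" "0 < b" "b < 2 * pi"
  shows "R_fun x y b - R_fun x y a
    = (cot (a / 2) - cot (b / 2)) * (seg x y a + seg x y b) / 2"
  using assms by (simp add: R_fun_cot seg_def algebra_simps power2_eq_square divide_simps)

lemma R_fun_mono:
  assumes "0 < a" "a \<le> b" "b < 2 * pi" "0 \<le> seg x y a" "0 \<le> seg x y b"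
  shows "R_fun x y a \<le> R_fun x y b"
proof (cases "a = b")
  case False
  then have "0 \<le> (cot (a / 2) - cot (b / 2)) * (seg x y a + seg x y b) / 2"
    using cot_decreasing[of "a / 2" "b / 2"] assms by simp
  then show ?thesis using R_fun_diff[of a b x y] assms by simp
qed simp

lemma R_fun_strict_mono:
  assumes "0 < a" "a < b" "b < 2 * pi" "0 < seg x y a" "0 \<le> seg x y b"
  shows "R_fun x y a < R_fun x y b"
proof -
  have "0 < (cot (a / 2) - cot (b / 2)) * (seg x y a + seg x y b) / 2"
    using cot_decreasing[of "a / 2" "b / 2"] assms by simp
  then show ?thesis using R_fun_diff[of a b x y] assms by simp
qed

lemma sin_cos_le:
  fixes u :: real
  assumes "0 \<le> u"
  shows "sin u * cos u \<le> u"
  using sin_x_le_x[of "2 * u"] assms by (simp add: sin_double)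

text \<open>With \<open>c = cot (\<theta> / 2)\<close>, both parts of the derivative contain the
  factor \<open>seg\<close>: the derivative of the radius does, and the radius plus the derivative
  of \<open>seg\<close> equals \<open>- c * seg\<close>.\<close>

lemma travel_deriv:
  assumes "0 < \<theta>" "\<theta> < 2 * pi"
  shows "(travel x y has_real_derivative
    seg x y \<theta> * ((\<theta> / 2 - sin (\<theta> / 2) * cos (\<theta> / 2)) / (sin (\<theta> / 2))\<^sup>2)) (at \<theta>)"
proof -
  define S C where "S = sin (\<theta> / 2)" and "C = cos (\<theta> / 2)"
  have S: "S > 0" using sin_half_pos[OF assms] by (simp add: S_def)
  have C: "C\<^sup>2 = 1 - S\<^sup>2" by (simp add: S_def C_def cos_squared_eq)
  define k where "k = (\<lambda>\<theta>::real. cot (\<theta> / 2))"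
  define D where "D = - (1 / (2 * S\<^sup>2))"
  have k: "(k has_real_derivative D) (at \<theta>)"
    using DERIV_chain2[of cot _ "\<lambda>\<theta>. \<theta> / 2" \<theta> "1 / 2" UNIV, OF DERIV_cot DERIV_cdivide[OF DERIV_ident]] S
    by (simp add: k_def D_def S_def inverse_eq_divide mult.commute)
  have "((\<lambda>\<theta>. (x * k \<theta> - y * ((k \<theta>)\<^sup>2 - 1) / 2) * \<theta> + (y * k \<theta> - x)) has_real_derivative
      (x * D - y * (2 * k \<theta> * D) / 2) * \<theta> + (x * k \<theta> - y * ((k \<theta>)\<^sup>2 - 1) / 2) + y * D) (at \<theta>)"
    by (auto intro!: derivative_eq_intros k simp: field_simps)
  also have "(x * D - y * (2 * k \<theta> * D) / 2) * \<theta> + (x * k \<theta> - y * ((k \<theta>)\<^sup>2 - 1) / 2) + y * D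
      = (y * k \<theta> - x) * (\<theta> / 2 * (- 2 * D) - k \<theta>)"
  proof -
    have D: "D = - (1 + (k \<theta>)\<^sup>2) / 2"
      using S C by (simp add: D_def k_def cot_def power_divide field_simps flip: S_def C_def)
    show ?thesis unfolding D by (simp add: field_simps power2_eq_square)
  qed
  also have "\<theta> / 2 * (- 2 * D) - k \<theta> = (\<theta> / 2 - S * C) / S\<^sup>2"
    using S by (simp add: D_def k_def cot_def field_simps power2_eq_square flip: S_def C_def)
  also have "y * k \<theta> - x = seg x y \<theta>" by (simp add: seg_def k_def)
  finally have "((\<lambda>\<theta>. (x * k \<theta> - y * ((k \<theta>)\<^sup>2 - 1) / 2) * \<theta> + (y * k \<theta> - x)) has_real_derivative
      seg x y \<theta> * ((\<theta> / 2 - S * C) / S\<^sup>2)) (at \<theta>)" .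
  \<comment> \<open>The cotangent form of the radius is available on this interval, so the
    derivative is transferred within it.\<close>
  moreover have "open {0<..<2 * pi}" "\<theta> \<in> {0<..<2 * pi}" using assms by auto
  ultimately show ?thesis
    unfolding S_def C_def
    by (rule has_field_derivative_transform_within_open)
      (auto simp: travel_def seg_def R_fun_cot k_def)
qed

lemma travel_mono:
  assumes "0 < a" "a \<le> b" "b < 2 * pi" "0 \<le> seg x y a" "0 \<le> seg x y b"
  shows "travel x y a \<le> travel x y b"
proof (rule DERIV_nonneg_imp_nondecreasing[OF assms(2)])
  fix \<theta> assume \<theta>: "a \<le> \<theta>" "\<theta> \<le> b"
  have "0 \<le> seg x y \<theta>"
    using seg_nonneg_between \<theta> assms by blast
  moreover have "0 \<le> (\<theta> / 2 - sin (\<theta> / 2) * cos (\<theta> / 2)) / (sin (\<theta> / 2))\<^sup>2"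
    using sin_cos_le[of "\<theta> / 2"] \<theta> assms(1) by simp
  ultimately show "\<exists>D. (travel x y has_real_derivative D) (at \<theta>) \<and> 0 \<le> D"
    using travel_deriv[of \<theta> x y] \<theta> assms by (meson le_less_trans less_le_trans mult_nonneg_nonneg)
qed

section \<open>Correspondence between path lengths and admissible bearings\<close>

lemma seg_zero_imp:
  assumes "0 < \<theta>" "\<theta> < 2 * pi" "seg x y \<theta> = 0" "0 < R_fun x y \<theta>"
  shows "0 < y" "x\<^sup>2 + y\<^sup>2 = 2 * R_fun x y \<theta> * y"
proof -
  define r where "r = R_fun x y \<theta>"
  have x: "x = r * sin \<theta>" and y: "y = r * (1 - cos \<theta>)"
    using end_point_iff[OF assms(1,2), of x 0 r y] assms(3) by (auto simp: r_def)
  have "1 - cos \<theta> > 0"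
    using sin_half_pos[OF assms(1,2)] sin_cos_half(2)[of \<theta>] by simp
  moreover have "0 < r" using assms(4) by (simp add: r_def)
  ultimately show "0 < y" by (simp add: y)
  \<comment> \<open>With no straight segment the point lies on the turning circle, of radius
    \<open>r\<close> about \<open>(0, r)\<close>.\<close>
  have "x\<^sup>2 + y\<^sup>2 = r\<^sup>2 * ((sin \<theta>)\<^sup>2 + (cos \<theta>)\<^sup>2 + 1 - 2 * cos \<theta>)"
    unfolding x y by algebra
  also have "\<dots> = r\<^sup>2 * (2 - 2 * cos \<theta>)"
    by simp
  also have "\<dots> = 2 * r * y"
    by (simp add: y power2_eq_square algebra_simps)
  finally show "x\<^sup>2 + y\<^sup>2 = 2 * R_fun x y \<theta> * y"
    by (simp add: r_def)
qed

text \<open>A point met during the turn is treated as the end of a path of smaller bearing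
  \<open>d / r\<close> with an empty segment. Only in that case may \<theta> be below
  \<theta>\<alpha>.\<close>

lemma path_lengthsE:
  assumes "d \<in> path_lengths r\<alpha> r\<beta> \<theta>\<alpha> \<theta>\<beta> x y" "0 < r\<alpha>" "0 < \<theta>\<alpha>" "\<theta>\<beta> < 2 * pi"
  obtains \<theta> where "0 < \<theta>" "\<theta> \<le> \<theta>\<beta>" "r\<alpha> \<le> R_fun x y \<theta>" "R_fun x y \<theta> \<le> r\<beta>"
    "0 \<le> seg x y \<theta>" "seg x y \<theta> = 0 \<or> \<theta>\<alpha> \<le> \<theta>" "d = travel x y \<theta>"
proof -
  obtain r t where d: "0 < d" and r: "r\<alpha> \<le> r" "r \<le> r\<beta>" and t: "\<theta>\<alpha> \<le> t" "t \<le> \<theta>\<beta>"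
    and eq: "turn_path r t d = (x, y)"
    using assms(1) by (auto simp: path_lengths_def)
  show thesis
  proof (cases "d \<le> r * t")
    case True
    define \<phi> where "\<phi> = d / r"
    have \<phi>: "0 < \<phi>" "\<phi> \<le> t"
      using True d r assms by (auto simp: \<phi>_def field_simps)
    have "x = 0 * cos \<phi> + r * sin \<phi> \<and> y = 0 * sin \<phi> + r * (1 - cos \<phi>)"
      using eq True by (auto simp: turn_path_def \<phi>_def)
    then have R: "r = R_fun x y \<phi>" and s: "seg x y \<phi> = 0"
      using end_point_iff[of \<phi> x 0 r y] \<phi> t assms(4) by auto
    have "d = travel x y \<phi>"
      using r assms by (simp add: travel_def s flip: R) (simp add: \<phi>_def)
    then show thesis
      using that[of \<phi>] \<phi> t r R s by simp
  next
    case False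
    define e where "e = d - r * t"
    have "x = e * cos t + r * sin t \<and> y = e * sin t + r * (1 - cos t)"
      using eq False by (auto simp: turn_path_def e_def)
    then have R: "r = R_fun x y t" and s: "e = seg x y t"
      using end_point_iff[of t x e r y] t assms by auto
    have "d = travel x y t"
      by (simp add: travel_def flip: R s) (simp add: e_def)
    then show thesis
      using that[of t] t r R s False assms by (simp add: e_def)
  qed
qed

text \<open>A positive segment puts the travelled distance strictly into the straight branch of
  \<open>turn_path\<close>.\<close>

lemma travel_in_path_lengths_straight:
  assumes "0 < \<theta>\<alpha>" "\<theta>\<beta> < 2 * pi" "\<theta>\<alpha> \<le> \<theta>" "\<theta> \<le> \<theta>\<beta>" "0 < seg x y \<theta>"
    "0 < r\<alpha>" "r\<alpha> \<le> R_fun x y \<theta>" "R_fun x y \<theta> \<le> r\<beta>"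
  shows "travel x y \<theta> \<in> path_lengths r\<alpha> r\<beta> \<theta>\<alpha> \<theta>\<beta> x y"
proof -
  have "turn_path (R_fun x y \<theta>) \<theta> (travel x y \<theta>) = (x, y)"
    using end_point_iff[of \<theta> x "seg x y \<theta>" "R_fun x y \<theta>" y] assms
    by (auto simp: turn_path_def travel_def)
  moreover have "0 < travel x y \<theta>"
    using assms by (simp add: travel_def add_pos_pos)
  ultimately show ?thesis
    using assms by (force simp: path_lengths_def)
qed

lemma travel_in_path_lengths_arc:
  assumes "\<theta>\<alpha> \<le> \<theta>\<beta>" "\<theta>\<beta> < 2 * pi" "0 < \<theta>" "\<theta> \<le> \<theta>\<beta>" "seg x y \<theta> = 0"
    "0 < r\<alpha>" "r\<alpha> \<le> R_fun x y \<theta>" "R_fun x y \<theta> \<le> r\<beta>"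
  shows "travel x y \<theta> \<in> path_lengths r\<alpha> r\<beta> \<theta>\<alpha> \<theta>\<beta> x y"
proof -
  \<comment> \<open>The witness keeps turning up to \<theta>\<beta> and meets the point on its arc,
    so \<theta> itself may be below \<theta>\<alpha>.\<close>
  have "turn_path (R_fun x y \<theta>) \<theta>\<beta> (travel x y \<theta>) = (x, y)"
    using end_point_iff[of \<theta> x "seg x y \<theta>" "R_fun x y \<theta>" y] assms
    by (auto simp: turn_path_def travel_def)
  moreover have "0 < travel x y \<theta>"
    using assms by (simp add: travel_def)
  ultimately show ?thesis
    using assms by (force simp: path_lengths_def)
qed

text \<open>Since \<open>travel\<close> is monotone, maximising the length reduces to finding an
  attained bearing that dominates all others.\<close>

lemma d_max_eq_L_fun:
  assumes "0 < r\<alpha>" "0 < \<theta>\<alpha>" "\<theta>\<beta> < 2 * pi"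
    and T: "0 < T" "T < 2 * pi" "0 \<le> seg x y T"
    and attained: "travel x y T \<in> path_lengths r\<alpha> r\<beta> \<theta>\<alpha> \<theta>\<beta> x y"
    and bound: "\<And>\<theta>. \<lbrakk>0 < \<theta>; \<theta> \<le> \<theta>\<beta>; R_fun x y \<theta> \<le> r\<beta>; 0 \<le> seg x y \<theta>\<rbrakk> \<Longrightarrow> \<theta> \<le> T"
  shows "d_max r\<alpha> r\<beta> \<theta>\<alpha> \<theta>\<beta> x y = L_fun x y T (R_fun x y T)"
proof -
  have "d \<le> travel x y T" if "d \<in> path_lengths r\<alpha> r\<beta> \<theta>\<alpha> \<theta>\<beta> x y" for d
    using that assms(1-3)
  proof (rule path_lengthsE)
    fix \<theta> assume "0 < \<theta>" "\<theta> \<le> \<theta>\<beta>" "R_fun x y \<theta> \<le> r\<beta>" "0 \<le> seg x y \<theta>" "d = travel x y \<theta>"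
    then show ?thesis
      using travel_mono[of \<theta> T x y] bound[of \<theta>] T by simp
  qed
  then have "d_max r\<alpha> r\<beta> \<theta>\<alpha> \<theta>\<beta> x y = travel x y T"
    unfolding d_max_def using attained by (intro cSup_eq_maximum) auto
  then show ?thesis
    using L_fun_eq_travel[OF T] by simp
qed

section \<open>The limiting bearings \<open>theta_m\<close> and \<open>Theta_fun\<close>\<close>

lemma theta_m_props:
  assumes "0 < y"
  shows "0 < theta_m x y" "theta_m x y < 2 * pi" "seg x y (theta_m x y) = 0"
    "R_fun x y (theta_m x y) = r_m x y"
proof -
  define z where "z = Complex x y"
  have z: "z \<noteq> 0" using assms by (simp add: z_def complex_eq_iff)
  have "0 < Arg z" "Arg z < pi"
    using Arg_lt_pi[of z] assms by (auto simp: z_def)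
  then show b: "0 < theta_m x y" "theta_m x y < 2 * pi"
    by (auto simp: theta_m_def z_def)
  \<comment> \<open>Polar coordinates give the cotangent of the polar angle as \<open>x / y\<close>,
    exactly where \<open>seg\<close> vanishes.\<close>
  have "cmod z * cos (Arg z) = x" "cmod z * sin (Arg z) = y"
    using rcis_cmod_Arg[of z] by (metis Re_rcis Im_rcis complex.sel z_def)+
  then have c: "cot (theta_m x y / 2) = x / y"
    using z by (auto simp: theta_m_def cot_def simp flip: z_def)
  show "seg x y (theta_m x y) = 0"
    using assms by (simp add: seg_def c)
  show "R_fun x y (theta_m x y) = r_m x y"
    using assms by (simp add: R_fun_cot[OF b] c r_m_def field_simps power2_eq_square)
qed

text \<open>For \<open>y > 0\<close> the segment length decreases strictly in the bearing, with its
  zero at \<open>theta_m\<close>.\<close>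

lemma seg_iff_theta_m:
  assumes "0 < y" "0 < \<theta>" "\<theta> < 2 * pi"
  shows "0 < seg x y \<theta> \<longleftrightarrow> \<theta> < theta_m x y" "0 \<le> seg x y \<theta> \<longleftrightarrow> \<theta> \<le> theta_m x y"
proof -
  note m = theta_m_props[OF assms(1), of x]
  have "seg x y b < seg x y a" if "0 < a" "a < b" "b < 2 * pi" for a b
    using cot_decreasing[of "a / 2" "b / 2"] that assms(1) by (simp add: seg_def)
  then show "0 < seg x y \<theta> \<longleftrightarrow> \<theta> < theta_m x y" "0 \<le> seg x y \<theta> \<longleftrightarrow> \<theta> \<le> theta_m x y"
    using m assms by (metis less_irrefl less_asym not_less_iff_gr_or_eq not_le)+
qed

text \<open>Here \<open>t\<close> is the tangent of the half bearing. Adding \<open>pi\<close> to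
  the half angle preserves it and moves a negative arctangent into the required range.\<close>

lemma cot_half_bearing:
  fixes t :: real
  assumes "t \<noteq> 0" "\<theta> = 2 * arctan t + (if 0 < t then 0 else 2 * pi)"
  shows "0 < \<theta>" "\<theta> < 2 * pi" "cot (\<theta> / 2) = 1 / t"
proof -
  have "\<theta> / 2 = (if 0 < t then arctan t else arctan t + pi)"
    using assms by simp
  then have "tan (\<theta> / 2) = t"
    by (simp only: if_distrib[of tan] tan_arctan tan_periodic_pi if_cancel)
  then show "cot (\<theta> / 2) = 1 / t"
    by (simp add: cot_altdef inverse_eq_divide)
  show "0 < \<theta>" "\<theta> < 2 * pi"
    using assms arctan_lbound[of t] arctan_ubound[of t]
    by (auto simp: zero_less_arctan_iff arctan_less_zero_iff split: if_splits)
qed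

text \<open>For \<open>t = tan (\<theta> / 2)\<close>, radius \<open>r\<close> means
  \<open>(2 * r - y) * t\<^sup>2 - 2 * x * t + y = 0\<close>. A quarter of its discriminant is the
  power of the point with respect to the turning circle, positive by hypothesis. Points with
  \<open>y = 0\<close> and \<open>x > 0\<close> are excluded: there \<open>t = 0\<close> and
  \<open>P_fun\<close> is unspecified.\<close>

lemma Theta_fun_props:
  assumes "0 < r" "x\<^sup>2 + y\<^sup>2 > 2 * r * y" "y = 0 \<Longrightarrow> x \<le> 0"
  shows "0 < Theta_fun x y r" "Theta_fun x y r < 2 * pi"
    "R_fun x y (Theta_fun x y r) = r" "0 < seg x y (Theta_fun x y r)"
proof -
  let ?T = "Theta_fun x y r"
  have "0 < ?T \<and> ?T < 2 * pi \<and> R_fun x y ?T = r \<and> 0 < seg x y ?T"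
  proof (cases "2 * r = y")
    \<comment> \<open>The quadratic degenerates to \<open>2 * x * t = y\<close>. Its finite root
      serves for \<open>x > 0\<close>; for \<open>x < 0\<close> the root at infinity, bearing
      \<open>pi\<close>, is the one with a positive segment.\<close>
    case True
    have "x \<noteq> 0" using assms True by (auto simp: power2_eq_square)
    show ?thesis
    proof (cases "0 < x")
      case pos: True
      have T: "?T = 2 * arctan (y / (2 * x))"
        using True pos by (simp add: Theta_fun_def)
      have t: "0 < y / (2 * x)" "y \<noteq> 0" using True assms(1) pos by auto
      have b: "0 < ?T" "?T < 2 * pi" and c: "cot (?T / 2) = 2 * x / y"
        using cot_half_bearing[of "y / (2 * x)" ?T] t T pos by simp_all
      have "R_fun x y ?T = r"
        unfolding R_fun_cot[OF b] c using True assms(1) by (auto simp: field_simps power2_eq_square)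
      moreover have "0 < seg x y ?T"
        unfolding seg_def c using True assms(1) pos by auto
      ultimately show ?thesis using b by simp
    next
      case False
      have T: "?T = pi" using True False assms(1) by (simp add: Theta_fun_def)
      have "cot (pi / 2) = 0" by (simp add: cot_def)
      then show ?thesis
        using True False \<open>x \<noteq> 0\<close> unfolding T by (auto simp: R_fun_def seg_def)
    qed
  next
    case False
    define q where "q = 2 * r - y"
    define s where "s = sqrt (x\<^sup>2 - q * y)"
    define t where "t = (x - s) / q"
    have q: "q \<noteq> 0" using False by (simp add: q_def)
    have pos: "0 < x\<^sup>2 - q * y"
      using assms(2) by (simp add: q_def algebra_simps power2_eq_square)
    have s: "0 < s" "s\<^sup>2 = x\<^sup>2 - q * y" using pos by (auto simp: s_def)
    have tq: "q * t = x - s" using q by (simp add: t_def)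
    have "q * (q * t\<^sup>2 - 2 * x * t + y) = (q * t)\<^sup>2 - 2 * x * (q * t) + q * y"
      by (simp add: algebra_simps power2_eq_square)
    also have "\<dots> = 0"
      unfolding tq using s(2) by (simp add: algebra_simps power2_eq_square)
    finally have root: "q * t\<^sup>2 - 2 * x * t + y = 0" using q by simp
    \<comment> \<open>The sign of \<open>t\<close> follows from that of \<open>q\<close> and from
      comparing \<open>s\<close> with \<open>x\<close>, where
      \<open>s\<^sup>2 = x\<^sup>2 - q * y\<close>. The case table of \<open>P_fun\<close> encodes
      this sign.\<close>
    have tP: "t \<noteq> 0 \<and> P_fun x y r = (if 0 < t then 0 else 2 * pi)"
    proof (cases "q < 0")
      case neg: True
      then have "q * y < 0" using assms(1) by (simp add: q_def mult_less_0_iff)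
      then have "x < s" using s by (intro power_less_imp_less_base[of x 2 s]) auto
      then have "0 < t" using neg by (simp add: t_def zero_less_divide_iff)
      moreover have "P_fun x y r = 0" using neg assms(1) by (auto simp: P_fun_def q_def)
      ultimately show ?thesis by simp
    next
      case False
      then have q0: "0 < q" using q by simp
      show ?thesis
      proof (cases "0 < x \<and> 0 < y")
        case xy: True
        then have "s < x" using s q0 by (intro power_less_imp_less_base[of s 2 x]) auto
        then have "0 < t" using q0 by (simp add: t_def)
        moreover have "P_fun x y r = 0" using xy assms(1) by (auto simp: P_fun_def)
        ultimately show ?thesis by simp
      next
        case xy: False
        \<comment> \<open>What else could remain is \<open>x = 0\<close> with \<open>y\<close>
          nonnegative, where the discriminant would not be positive, or the excluded positive
          x-axis.\<close>
        have neg: "x < 0 \<or> 0 \<le> x \<and> y < 0"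
        proof (rule ccontr)
          assume "\<not> ?thesis"
          then have "x = 0" "0 \<le> y" using xy assms(3) by (auto simp: not_less)
          then show False using pos q0 by (auto simp: mult_less_0_iff)
        qed
        have "x < s"
        proof (cases "x < 0")
          case False
          then have "q * y < 0" using neg q0 by (simp add: mult_less_0_iff)
          then show ?thesis using s by (intro power_less_imp_less_base[of x 2 s]) auto
        qed (use s in simp)
        then have "t < 0" using q0 by (simp add: t_def divide_less_0_iff)
        moreover have "P_fun x y r = 2 * pi"
          using neg q0 assms(1) by (auto simp: P_fun_def q_def)
        ultimately show ?thesis by simp
      qed
    qed
    have "?T = 2 * arctan t + (if 0 < t then 0 else 2 * pi)"
      using q tP by (simp add: Theta_fun_def t_def s_def q_def)
    note h = cot_half_bearing[OF conjunct1[OF tP] this]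
    have y: "y = 2 * x * t - q * t\<^sup>2" using root by simp
    have t0: "t \<noteq> 0" using tP by simp
    have "R_fun x y ?T = (2 * x * t - y + y * t\<^sup>2) / (2 * t\<^sup>2)"
      unfolding R_fun_cot[OF h(1,2)] h(3) using t0 by (simp add: field_simps power2_eq_square)
    also have "\<dots> = (q + y) / 2"
      using t0 y by (simp add: field_simps)
    finally have "R_fun x y ?T = r" by (simp add: q_def)
    \<comment> \<open>The minus sign before the square root in \<open>t\<close> makes the segment
      \<open>s\<close>, the tangent length, and not \<open>- s\<close>.\<close>
    moreover have "seg x y ?T = s"
    proof -
      have "seg x y ?T * t = s * t"
        unfolding seg_def h(3) using t0 y tq by (simp add: field_simps) algebra
      then show ?thesis using t0 by simp
    qed
    ultimately show ?thesis using h s by simp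
  qed
  then show "0 < ?T" "?T < 2 * pi" "R_fun x y ?T = r" "0 < seg x y ?T" by auto
qed

lemma r_m_pos_imp:
  assumes "0 < r_m x y"
  shows "0 < y"
  using assms sum_power2_ge_zero[of x y] by (auto simp: r_m_def zero_less_divide_iff)

section \<open>The three cases of the maximal length\<close>

theorem theorem10:
  fixes r\<alpha> r\<beta> \<theta>\<alpha> \<theta>\<beta> x y :: real
  assumes "0 < r\<alpha>" and "r\<alpha> \<le> r\<beta>"
    and "0 < \<theta>\<alpha>" and "\<theta>\<alpha> < \<theta>\<beta>" and "\<theta>\<beta> < 2 * pi"
    and "(x, y) \<noteq> (0, 0)"
    and "reachable r\<alpha> r\<beta> \<theta>\<alpha> \<theta>\<beta> x y"
  shows "(x\<^sup>2 + y\<^sup>2 > 2 * r\<beta> * y \<and> Theta_fun x y r\<beta> \<le> \<theta>\<beta> \<longrightarrow>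
           d_max r\<alpha> r\<beta> \<theta>\<alpha> \<theta>\<beta> x y = L_fun x y (Theta_fun x y r\<beta>) r\<beta>)
    \<and> ((x\<^sup>2 + y\<^sup>2 > 2 * r\<beta> * y \<and> \<theta>\<beta> < Theta_fun x y r\<beta>) \<or>
         (y \<noteq> 0 \<and> r\<alpha> \<le> r_m x y \<and> r_m x y \<le> r\<beta> \<and> \<theta>\<beta> < theta_m x y) \<longrightarrow>
           d_max r\<alpha> r\<beta> \<theta>\<alpha> \<theta>\<beta> x y = L_fun x y \<theta>\<beta> (R_fun x y \<theta>\<beta>))
    \<and> (y \<noteq> 0 \<and> r\<alpha> \<le> r_m x y \<and> r_m x y \<le> r\<beta> \<and> theta_m x y \<le> \<theta>\<beta> \<longrightarrow>
           d_max r\<alpha> r\<beta> \<theta>\<alpha> \<theta>\<beta> x y = L_fun x y (theta_m x y) (r_m x y))"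
proof (intro conjI impI)
  have pos: "0 < r\<beta>" using assms by simp
  obtain d where d: "d \<in> path_lengths r\<alpha> r\<beta> \<theta>\<alpha> \<theta>\<beta> x y"
    using assms(7) path_lengths_nonempty by blast
  \<comment> \<open>The bearing of one given path serves below as the left end of the monotonicity
    intervals.\<close>
  obtain t where t: "0 < t" "t \<le> \<theta>\<beta>" "r\<alpha> \<le> R_fun x y t" "R_fun x y t \<le> r\<beta>"
    "0 \<le> seg x y t" "seg x y t = 0 \<or> \<theta>\<alpha> \<le> t"
    using path_lengthsE[OF d assms(1,3,5)] by metis
  let ?T = "Theta_fun x y r\<beta>"
  have outside: "0 < ?T \<and> ?T < 2 * pi \<and> R_fun x y ?T = r\<beta> \<and> 0 < seg x y ?T \<and> 0 < seg x y t
      \<and> (\<forall>\<theta>. 0 < \<theta> \<and> \<theta> < 2 * pi \<and> R_fun x y \<theta> \<le> r\<beta> \<and> 0 \<le> seg x y \<theta> \<longrightarrow> \<theta> \<le> ?T)"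
    if out: "2 * r\<beta> * y < x\<^sup>2 + y\<^sup>2"
  proof -
    have "y = 0 \<Longrightarrow> x \<le> 0" using t(5) by (simp add: seg_def)
    note T = Theta_fun_props[OF pos out this]
    \<comment> \<open>Otherwise the point would lie on a turning circle of radius at most r\<beta>,
      hence not outside the one of radius r\<beta>.\<close>
    have "seg x y t \<noteq> 0"
    proof
      assume "seg x y t = 0"
      then have "0 < y" "x\<^sup>2 + y\<^sup>2 = 2 * R_fun x y t * y"
        using seg_zero_imp[of t x y] t assms by auto
      then show False using out t(4) by simp
    qed
    \<comment> \<open>Beyond \<open>?T\<close> the radius would exceed r\<beta>, by strict
      monotonicity.\<close>
    moreover have "\<theta> \<le> ?T"
      if "0 < \<theta>" "\<theta> < 2 * pi" "R_fun x y \<theta> \<le> r\<beta>" "0 \<le> seg x y \<theta>" for \<theta>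
      using R_fun_strict_mono[of ?T \<theta> x y] that T by force
    ultimately show ?thesis using T t(5) by simp
  qed
  {
    assume i: "2 * r\<beta> * y < x\<^sup>2 + y\<^sup>2 \<and> ?T \<le> \<theta>\<beta>"
    note T = outside[OF conjunct1[OF i]]
    \<comment> \<open>As the segment at \<open>t\<close> is nonempty, \<theta>\<alpha> bounds
      \<open>t\<close> from below, and therefore also \<open>?T\<close>.\<close>
    have "t \<le> ?T" "t < 2 * pi" "\<theta>\<alpha> \<le> t" using T t assms by auto
    then have "travel x y ?T \<in> path_lengths r\<alpha> r\<beta> \<theta>\<alpha> \<theta>\<beta> x y"
      using T i assms(1-5) by (intro travel_in_path_lengths_straight) auto
    then have "d_max r\<alpha> r\<beta> \<theta>\<alpha> \<theta>\<beta> x y = L_fun x y ?T (R_fun x y ?T)"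
      using T assms by (intro d_max_eq_L_fun) auto
    then show "d_max r\<alpha> r\<beta> \<theta>\<alpha> \<theta>\<beta> x y = L_fun x y ?T r\<beta>" using T by simp
  next
    assume ii: "2 * r\<beta> * y < x\<^sup>2 + y\<^sup>2 \<and> \<theta>\<beta> < ?T \<or>
      y \<noteq> 0 \<and> r\<alpha> \<le> r_m x y \<and> r_m x y \<le> r\<beta> \<and> \<theta>\<beta> < theta_m x y"
    \<comment> \<open>Both alternatives provide a bearing beyond \<theta>\<beta> with nonnegative
      segment and radius at most r\<beta>: \<open>?T\<close> or \<open>theta_m x y\<close>. Then
      \<theta>\<beta> lies between \<open>t\<close> and \<open>T\<close>, so its segment is positive
      and its radius stays within the limits.\<close>
    have "\<exists>T. \<theta>\<beta> < T \<and> T < 2 * pi \<and> 0 \<le> seg x y T \<and> R_fun x y T \<le> r\<beta> \<and> 0 < seg x y t"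
      using ii
    proof
      assume "2 * r\<beta> * y < x\<^sup>2 + y\<^sup>2 \<and> \<theta>\<beta> < ?T"
      then show ?thesis using outside by (intro exI[of _ ?T]) auto
    next
      assume m: "y \<noteq> 0 \<and> r\<alpha> \<le> r_m x y \<and> r_m x y \<le> r\<beta> \<and> \<theta>\<beta> < theta_m x y"
      then have y: "0 < y" using r_m_pos_imp[of x y] assms(1) by simp
      show ?thesis
        using theta_m_props[OF y, of x] seg_iff_theta_m(1)[OF y, of t x] m t assms
        by (intro exI[of _ "theta_m x y"]) auto
    qed
    then obtain T where T: "\<theta>\<beta> < T" "T < 2 * pi" "0 \<le> seg x y T" "R_fun x y T \<le> r\<beta>"
      and s: "0 < seg x y t" by blast
    have "0 < seg x y \<theta>\<beta>" using seg_pos_between[of t \<theta>\<beta> T x y] t T s by simp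
    moreover from this have "R_fun x y t \<le> R_fun x y \<theta>\<beta>" "R_fun x y \<theta>\<beta> \<le> R_fun x y T"
      using R_fun_mono[of t \<theta>\<beta> x y] R_fun_mono[of \<theta>\<beta> T x y] t T assms by simp_all
    ultimately show "d_max r\<alpha> r\<beta> \<theta>\<alpha> \<theta>\<beta> x y = L_fun x y \<theta>\<beta> (R_fun x y \<theta>\<beta>)"
      using T t assms by (intro d_max_eq_L_fun travel_in_path_lengths_straight) auto
  next
    assume m: "y \<noteq> 0 \<and> r\<alpha> \<le> r_m x y \<and> r_m x y \<le> r\<beta> \<and> theta_m x y \<le> \<theta>\<beta>"
    then have y: "0 < y" using r_m_pos_imp[of x y] assms(1) by simp
    note M = theta_m_props[OF y, of x]
    \<comment> \<open>The point lies on the turning circle of radius \<open>r_m x y\<close>, so an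
      arc alone reaches it.\<close>
    have "travel x y (theta_m x y) \<in> path_lengths r\<alpha> r\<beta> \<theta>\<alpha> \<theta>\<beta> x y"
      using M m assms by (intro travel_in_path_lengths_arc) auto
    then have "d_max r\<alpha> r\<beta> \<theta>\<alpha> \<theta>\<beta> x y = L_fun x y (theta_m x y) (R_fun x y (theta_m x y))"
      using M seg_iff_theta_m(2)[OF y] assms by (intro d_max_eq_L_fun) auto
    then show "d_max r\<alpha> r\<beta> \<theta>\<alpha> \<theta>\<beta> x y = L_fun x y (theta_m x y) (r_m x y)" using M by simp
  }
qed

end
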